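(* Let $w_{\sigma}$ be the $\sigma$-sequence over the alphabet $\{1,3\}$. There does not exist a morphism $f:\{1,3\}^{\star}\to\{1,3\}^{\star}$ whose iteration defines $w_{\sigma}$, i.e. there is no morphism $f$ with $w_{\sigma}=\lim_{k\to\infty}f^k(1)$ (meaning $|f^k(1)|\to\infty$ and, for every $N$, the first $N$ letters of $f^k(1)$ coincide with the first $N$ letters of $w_\sigma$ for all sufficiently large $k$).
   Context: Every natural number $n\ge 1$ can be written uniquely as $n=2^t(4s+\sigma)$ with integers $t,s\ge 0$ and $\sigma\in\{1,3\}$ (here $2^t$ is the largest power of $2$ dividing $n$). The $\sigma$-sequence $w_\sigma$ is the infinite sequence whose $n$-th letter ($n=1,2,3,\dots$) is this value $\sigma$ for $n$; it begins $11311331113313\ldots$. A morphism $f$ on $\{1,3\}^{\star}$ (the set of finite words over $\{1,3\}$) is a map with $f(uv)=f(u)f(v)$ for all words $u,v$. *)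

theory Defs
  imports Complex_Main "HOL-Library.FuncSet"
begin

text \<open>The letter at position \<open>n \<ge> 1\<close>; positions are counted from 1, the value at 0 is irrelevant.\<close>

definition w_sigma :: "nat \<Rightarrow> nat" where
  "w_sigma n = (THE \<sigma>. \<sigma> \<in> {1, 3} \<and> (\<exists>t s. n = 2 ^ t * (4 * s + \<sigma>)))"

lemma sigma_exists:
  assumes "n \<ge> (1::nat)"
  shows "\<exists>\<sigma>\<in>{1, 3}. \<exists>t s. n = 2 ^ t * (4 * s + \<sigma>)"
  using assms
proof (induction n rule: less_induct)
  case (less n)
  show ?case
  proof (cases "even n")
    case True
    then obtain m where m: "n = 2 * m" by (elim evenE)
    with less.prems have "m < n" "m \<ge> 1" by auto
    with less.IH obtain \<sigma> t s where "\<sigma> \<in> {1, 3}" "m = 2 ^ t * (4 * s + \<sigma>)" by blast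
    moreover from this m have "n = 2 ^ Suc t * (4 * s + \<sigma>)" by simp
    ultimately show ?thesis by blast
  next
    case False
    then have "n mod 4 = 1 \<or> n mod 4 = 3" by presburger
    moreover have "n = 2 ^ 0 * (4 * (n div 4) + n mod 4)" by simp
    ultimately show ?thesis by (metis insertCI)
  qed
qed

lemma sigma_representation_unique:
  fixes t t' s s' a b :: nat
  assumes "a \<in> {1, 3}" "b \<in> {1, 3}"
    and "2 ^ t * (4 * s + a) = 2 ^ t' * (4 * s' + b)"
  shows "t = t' \<and> s = s' \<and> a = b"
  using assms(3)
proof (induction t arbitrary: t')
  case 0
  show ?case
  proof (cases t')
    case 0
    with \<open>2 ^ 0 * _ = _\<close> have "4 * s + a = 4 * s' + b" by simp
    with assms(1,2) 0 show ?thesis by (auto, presburger+)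
  next
    case (Suc r)
    have "odd (4 * s + a)" using assms(1) by auto
    moreover have "even (4 * s + a)" using 0 Suc by simp
    ultimately show ?thesis by blast
  qed
next
  case (Suc t)
  show ?case
  proof (cases t')
    case 0
    have "odd (4 * s' + b)" using assms(2) by auto
    moreover have "4 * s' + b = 2 * (2 ^ t * (4 * s + a))" using Suc.prems 0 by simp
    ultimately show ?thesis by (metis dvd_triv_left)
  next
    case (Suc r)
    with Suc.prems Suc.IH[of r] show ?thesis by simp
  qed
qed

lemma w_sigma_eq:
  assumes "\<sigma> \<in> {1, 3}"
  shows "w_sigma (2 ^ t * (4 * s + \<sigma>)) = \<sigma>"
  unfolding w_sigma_def
proof (rule the_equality)
  show "\<sigma> \<in> {1, 3} \<and> (\<exists>t' s'. 2 ^ t * (4 * s + \<sigma>) = 2 ^ t' * (4 * s' + \<sigma>))"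
    using assms by blast
next
  fix b
  assume "b \<in> {1, 3} \<and> (\<exists>t' s'. 2 ^ t * (4 * s + \<sigma>) = 2 ^ t' * (4 * s' + b))"
  then show "b = \<sigma>" using sigma_representation_unique[OF assms] by metis
qed

text \<open>No condition is imposed on \<open>f\<close> outside \<open>lists A\<close>, and erasing morphisms are allowed;
  \<open>f [] = []\<close> follows from the equation.\<close>

definition word_morphism :: "'a set \<Rightarrow> ('a list \<Rightarrow> 'a list) \<Rightarrow> bool" where
  "word_morphism A f \<longleftrightarrow>
     f \<in> lists A \<rightarrow> lists A \<and> (\<forall>u\<in>lists A. \<forall>v\<in>lists A. f (u @ v) = f u @ f v)"

text \<open>Convergence of finite words to an infinite word \<open>w\<close> indexed from 1.\<close>

definition words_converge_to :: "(nat \<Rightarrow> 'a list) \<Rightarrow> (nat \<Rightarrow> 'a) \<Rightarrow> bool" where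
  "words_converge_to u w \<longleftrightarrow>
     filterlim (\<lambda>k. length (u k)) at_top sequentially \<and>
     (\<forall>N. \<forall>\<^sub>F k in sequentially. take N (u k) = map w [1..<N + 1])"

end

theory Submission
  imports Defs
begin

text \<open>
  A defining morphism \<open>f\<close> maps prefixes of \<open>w = w_sigma\<close> to prefixes of \<open>w\<close>, so with
  \<open>X = f(1)\<close> and \<open>Y = f(3)\<close> the word \<open>f(1131133) = XXYXXYY\<close> is a prefix of \<open>w\<close>. The letters of \<open>w\<close>
  at odd positions alternate, and \<open>w(2n) = w(n)\<close>. These two facts leave only \<open>|X| = 3\<close> for a square
  prefix \<open>XX\<close> with \<open>|X| \<ge> 2\<close>, so \<open>X = 113\<close>. The second occurrence of \<open>XX\<close> then forces
  \<open>|Y| \<equiv> 2 (mod 4)\<close>, and for such a period the square \<open>YY\<close> contradicts the alternation.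
\<close>

lemma w_sigma_4_1: "n mod 4 = 1 \<Longrightarrow> w_sigma n = 1"
  using w_sigma_eq[of 1 0 "n div 4"] mult_div_mod_eq[of 4 n] by simp

lemma w_sigma_4_3: "n mod 4 = 3 \<Longrightarrow> w_sigma n = 3"
  using w_sigma_eq[of 3 0 "n div 4"] mult_div_mod_eq[of 4 n] by simp

lemma w_sigma_double:
  assumes "n \<ge> 1"
  shows "w_sigma (2 * n) = w_sigma n"
proof -
  obtain \<sigma> t s where "\<sigma> \<in> {1, 3}" and n: "n = 2 ^ t * (4 * s + \<sigma>)"
    using sigma_exists[OF assms] by blast
  moreover have "2 * n = 2 ^ Suc t * (4 * s + \<sigma>)"
    using n by simp
  ultimately show ?thesis
    using w_sigma_eq by metis
qed

lemma w_sigma_odd_add_2: "odd n \<Longrightarrow> w_sigma (n + 2) \<noteq> w_sigma n"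
proof -
  assume "odd n"
  then have "n mod 4 = 1 \<and> (n + 2) mod 4 = 3 \<or> n mod 4 = 3 \<and> (n + 2) mod 4 = 1"
    by presburger
  then show ?thesis
    using w_sigma_4_1 w_sigma_4_3 by (metis numeral_eq_one_iff semiring_norm(86))
qed

text \<open>Such a shift exchanges the residues 1 and 3 modulo 4, which determine the letters at odd
  positions.\<close>

lemma w_sigma_odd_add_2_mod_4:
  assumes "odd n" "q mod 4 = 2"
  shows "w_sigma (n + q) \<noteq> w_sigma n"
proof -
  have "n mod 4 = 1 \<and> (n + q) mod 4 = 3 \<or> n mod 4 = 3 \<and> (n + q) mod 4 = 1"
    using assms by presburger
  then show ?thesis
    using w_sigma_4_1 w_sigma_4_3 by (metis numeral_eq_one_iff semiring_norm(86))
qed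

lemma w_sigma_values:
  "w_sigma 1 = 1" "w_sigma 2 = 1" "w_sigma 3 = 3" "w_sigma 4 = 1"
  "w_sigma 5 = 1" "w_sigma 6 = 3" "w_sigma 7 = 3"
  using w_sigma_4_1[of 1] w_sigma_4_3[of 3] w_sigma_4_1[of 5] w_sigma_4_3[of 7]
    w_sigma_double[of 1] w_sigma_double[of 2] w_sigma_double[of 3] by simp_all

text \<open>A longer odd period would copy the equal letters at positions 2 and 4 to the consecutive
  odd positions \<open>p + 2\<close> and \<open>p + 4\<close>, where letters must differ.\<close>

lemma odd_square_prefix_w_sigma:
  assumes "odd p" "\<And>j. 1 \<le> j \<Longrightarrow> j \<le> p \<Longrightarrow> w_sigma (j + p) = w_sigma j"
  shows "p < 4"
proof (rule ccontr)
  assume "\<not> p < 4"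
  then have "w_sigma (p + 2) = 1" "w_sigma (p + 4) = 1"
    using assms(2)[of 2] assms(2)[of 4] w_sigma_values by (simp_all add: add.commute)
  moreover have "odd (p + 2)"
    using assms(1) by simp
  ultimately show False
    using w_sigma_odd_add_2[of "p + 2"] by (simp add: add.commute del: add_2_eq_Suc')
qed

text \<open>Restricting a square prefix of period \<open>4 * m\<close> to even positions halves its period.\<close>

lemma no_even_square_prefix_w_sigma:
  assumes "even p" "p > 0"
  shows "\<exists>j. 1 \<le> j \<and> j \<le> p \<and> w_sigma (j + p) \<noteq> w_sigma j"
  using assms
proof (induction p rule: less_induct)
  case (less p)
  have "p mod 4 = 2 \<or> 4 dvd p"
    using less.prems(1) by presburger
  then consider "p mod 4 = 2" | "4 dvd p"
    by blast
  then show ?case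
  proof cases
    case 1
    then show ?thesis
      using w_sigma_odd_add_2_mod_4[of 1 p] less.prems by (intro exI[of _ 1]) auto
  next
    case 2
    then obtain m where p: "p = 4 * m" ..
    with less.IH[of "2 * m"] less.prems(2)
    obtain j where j: "1 \<le> j" "j \<le> 2 * m" "w_sigma (j + 2 * m) \<noteq> w_sigma j"
      by auto
    have "w_sigma (2 * j + p) = w_sigma (j + 2 * m)"
      using w_sigma_double[of "j + 2 * m"] j(1) p by (simp add: algebra_simps)
    then have "w_sigma (2 * j + p) \<noteq> w_sigma (2 * j)"
      using w_sigma_double[OF j(1)] j(3) by simp
    then show ?thesis
      using j p by (intro exI[of _ "2 * j"]) auto
  qed
qed

text \<open>The lower bound excludes the genuine square prefix \<open>11\<close>.\<close>

lemma square_prefix_w_sigma: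
  assumes "p \<ge> 2" "\<And>j. 1 \<le> j \<Longrightarrow> j \<le> p \<Longrightarrow> w_sigma (j + p) = w_sigma j"
  shows "p = 3"
proof -
  have "odd p"
    using no_even_square_prefix_w_sigma[of p] assms by fastforce
  moreover from this have "p < 4"
    using odd_square_prefix_w_sigma assms(2) by blast
  ultimately show ?thesis
    using assms(1) by presburger
qed

lemma word_morphism_funpow_in_lists:
  assumes "word_morphism A f" "u \<in> lists A"
  shows "(f ^^ k) u \<in> lists A"
  using assms by (induction k) (auto simp: word_morphism_def)

lemma word_morphism_Nil:
  assumes "word_morphism A f"
  shows "f [] = []"
proof -
  have "f ([] @ []) = f [] @ f []"
    using assms unfolding word_morphism_def by blast
  then show ?thesis
    by simp
qed

lemma word_morphism_Cons:
  assumes "word_morphism A f" "a \<in> A" "u \<in> lists A"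
  shows "f (a # u) = f [a] @ f u"
proof -
  have "[a] \<in> lists A"
    using assms by simp
  then have "f ([a] @ u) = f [a] @ f u"
    using assms unfolding word_morphism_def by blast
  then show ?thesis
    by simp
qed

text \<open>For one large \<open>k\<close>, the prefix \<open>p\<close> of length \<open>n\<close>
  begins the \<open>k\<close>-th iterate, so \<open>f p\<close> begins the next one, which already
  agrees with \<open>w\<close> on \<open>length (f p)\<close> letters.\<close>

lemma word_morphism_maps_limit_prefix:
  assumes f: "word_morphism A f" and u: "u \<in> lists A"
    and conv: "words_converge_to (\<lambda>k. (f ^^ k) u) w"
  shows "\<exists>M. f (map w [1..<n + 1]) = map w [1..<M + 1]"
proof -
  define p where "p = map w [1..<n + 1]"
  define M where "M = length (f p)"
  have "\<forall>\<^sub>F k in sequentially. take n ((f ^^ k) u) = p"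
    and M: "\<forall>\<^sub>F k in sequentially. take M ((f ^^ k) u) = map w [1..<M + 1]"
    using conv unfolding words_converge_to_def p_def by blast+
  moreover have "\<forall>\<^sub>F k in sequentially. take M ((f ^^ Suc k) u) = map w [1..<M + 1]"
    using M by (subst eventually_sequentially_Suc)
  ultimately have "\<forall>\<^sub>F k in sequentially. take n ((f ^^ k) u) = p
      \<and> take M ((f ^^ Suc k) u) = map w [1..<M + 1]"
    by (simp add: eventually_conj_iff)
  then obtain k where k: "take n ((f ^^ k) u) = p" "take M ((f ^^ Suc k) u) = map w [1..<M + 1]"
    using eventually_happens'[OF sequentially_bot] by blast
  define v where "v = (f ^^ k) u"
  have "v \<in> lists A"
    unfolding v_def using word_morphism_funpow_in_lists[OF f u] .
  then have "take n v \<in> lists A" "drop n v \<in> lists A"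
    by (auto dest: in_set_takeD in_set_dropD)
  then have "f (take n v @ drop n v) = f (take n v) @ f (drop n v)"
    using f unfolding word_morphism_def by blast
  then have "f v = f p @ f (drop n v)"
    \<comment> \<open>Two passes: rewriting \<open>take n v\<close> to \<open>p\<close> first would
      block \<open>append_take_drop_id\<close>.\<close>
    by (simp only: append_take_drop_id) (simp only: k(1)[folded v_def])
  then have "f p = map w [1..<M + 1]"
    using k(2) by (simp add: v_def M_def)
  then show ?thesis
    unfolding p_def by blast
qed

lemma nth_append_append: "k < length v \<Longrightarrow> (u @ v @ z) ! (length u + k) = v ! k"
  by (simp add: nth_append)

text \<open>Applied to two occurrences of the same factor, this equates letters of \<open>w\<close>
  at shifted positions.\<close>

lemma nth_factor_of_prefix:
  assumes "u @ v @ z = map w [1..<M + 1]" "1 \<le> j" "j \<le> length v"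
  shows "v ! (j - 1) = w (length u + j)"
proof -
  have "length u + length v + length z = M"
    using arg_cong[OF assms(1), of length] by (simp del: upt_Suc)
  then have "map w [1..<M + 1] ! (length u + (j - 1)) = w (length u + j)"
    using assms(2,3) by (simp del: upt_Suc)
  then show ?thesis
    using nth_append_append[of "j - 1" v u z] assms by simp
qed

theorem theorem10:
  "\<not> (\<exists>f :: nat list \<Rightarrow> nat list.
        word_morphism {1, 3} f \<and> words_converge_to (\<lambda>k. (f ^^ k) [1]) w_sigma)"
proof
  assume "\<exists>f :: nat list \<Rightarrow> nat list.
        word_morphism {1, 3} f \<and> words_converge_to (\<lambda>k. (f ^^ k) [1]) w_sigma"
  then obtain f :: "nat list \<Rightarrow> nat list" where f: "word_morphism {1, 3} f"
    and conv: "words_converge_to (\<lambda>k. (f ^^ k) [1]) w_sigma"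
    by blast
  define X where "X = f [1]"
  define Y where "Y = f [3]"
  define p where "p = length X"
  define q where "q = length Y"
  \<comment> \<open>Seven letters form the shortest prefix of \<open>w_sigma\<close> containing the
    square \<open>33\<close>.\<close>
  obtain M where M: "f (map w_sigma [1..<7 + 1]) = map w_sigma [1..<M + 1]"
    using word_morphism_maps_limit_prefix[OF f _ conv, of 7] by auto
  have "map w_sigma [1..<7 + 1] = [1, 1, 3, 1, 1, 3, 3]"
    using w_sigma_values by (simp add: upt_rec numeral_eq_Suc)
  then have prefix: "X @ X @ Y @ X @ X @ Y @ Y = map w_sigma [1..<M + 1]"
    \<comment> \<open>The pattern \<open>_ # _\<close> keeps \<open>f [a]\<close> from being
      unfolded to \<open>f [a] @ f []\<close>.\<close>
    using M by (simp add: word_morphism_Cons[OF f, of _ "_ # _"] X_def Y_def del: upt_Suc)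
  note factor = nth_factor_of_prefix[where w = w_sigma and M = M]
  have X1: "X ! (j - 1) = w_sigma j" if "1 \<le> j" "j \<le> p" for j
    using factor[of "[]" X _ j] prefix that by (simp add: p_def)
  have X2: "X ! (j - 1) = w_sigma (p + j)" if "1 \<le> j" "j \<le> p" for j
    using factor[of X X _ j] prefix that by (simp add: p_def)
  have square: "w_sigma (j + p) = w_sigma j" if "1 \<le> j" "j \<le> p" for j
    using X1[OF that] X2[OF that] by (simp add: add.commute)
  \<comment> \<open>Otherwise \<open>X\<close> is empty or \<open>[1]\<close>, and no iterate grows
    beyond one letter.\<close>
  have "p \<ge> 2"
  proof (rule ccontr)
    assume "\<not> p \<ge> 2"
    then have "length X = 0 \<or> length X = 1"
      unfolding p_def by linarith
    then have X: "X = [] \<or> X = [1]"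
    proof
      assume "length X = 1"
      moreover from this have "X ! 0 = 1"
        using X1[of 1] w_sigma_values(1) by (simp add: p_def)
      ultimately show ?thesis
        by (cases X) auto
    qed simp
    have iter: "(f ^^ k) [1] \<in> {[], [1]}" for k
      using X word_morphism_Nil[OF f] by (induction k) (auto simp: X_def)
    have "\<forall>\<^sub>F k in sequentially. length ((f ^^ k) [1]) \<ge> 2"
      using conv unfolding words_converge_to_def filterlim_at_top by blast
    then obtain k where "length ((f ^^ k) [1]) \<ge> 2"
      using eventually_happens'[OF sequentially_bot] by blast
    then show False
      using iter[of k] by auto
  qed
  then have p: "p = 3"
    using square_prefix_w_sigma square by blast
  \<comment> \<open>The second \<open>XX\<close> starts after \<open>XXY\<close>, hence after
    \<open>q + 6\<close> letters.\<close>
  have X3: "w_sigma (q + 6 + j) = w_sigma j" if "1 \<le> j" "j \<le> 3" for j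
    using factor[of "X @ X @ Y" X "X @ Y @ Y" j] prefix that X1[of j] p
    by (simp add: p_def q_def algebra_simps)
  have X4: "w_sigma (q + 9 + j) = w_sigma j" if "1 \<le> j" "j \<le> 3" for j
    using factor[of "X @ X @ Y @ X" X "Y @ Y" j] prefix that X1[of j] p
    by (simp add: p_def q_def algebra_simps)
  have w7: "w_sigma (q + 7) = 1" and w8: "w_sigma (q + 8) = 1" and w10: "w_sigma (q + 10) = 1"
    using X3[of 1] X3[of 2] X4[of 1] w_sigma_values by (simp_all add: algebra_simps)
  \<comment> \<open>Equal letters at distance 2 cannot stand at odd positions, so
    \<open>q + 8\<close> is even.\<close>
  have "even q"
    using w_sigma_odd_add_2[of "q + 8"] w8 w10 by (auto simp: add.commute)
  moreover have "(q + 7) mod 4 \<noteq> 3"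
    using w_sigma_4_3[of "q + 7"] w7 by auto
  ultimately have q: "q mod 4 = 2"
    by presburger
  then have "q \<ge> 1"
    by (cases q) auto
  \<comment> \<open>The final \<open>YY\<close> begins after \<open>XXYXX\<close>, of length
    \<open>q + 12\<close>. Its two copies of \<open>Y\<close> thus begin at odd positions at
    distance \<open>q\<close>.\<close>
  have "Y ! 0 = w_sigma (q + 13)"
    using factor[of "X @ X @ Y @ X @ X" Y Y 1] prefix \<open>q \<ge> 1\<close> p
    by (simp add: p_def q_def algebra_simps)
  moreover have "Y ! 0 = w_sigma (q + 13 + q)"
    using factor[of "X @ X @ Y @ X @ X @ Y" Y "[]" 1] prefix \<open>q \<ge> 1\<close> p
    by (simp add: p_def q_def algebra_simps)
  ultimately show False
    using w_sigma_odd_add_2_mod_4[of "q + 13" q] \<open>even q\<close> q by simp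
qed

end
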